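(* Fix $d\ge1$. For $L\ge1$ let $N=L^d$, let $q_N\in[0,1]$, $p_N=1-q_N$, and let $X_L=X_L^d(q_N)$ be bond percolation on the torus $T_L^d$ with retention probability $q_N$. Suppose $$Lp_N\longrightarrow0\qquad(L\to\infty).$$ If $L$ ranges over all positive integers, then $(X_L)$ does not have an $\mathrm{MSO}_1$ convergence law, and hence does not have an $\mathrm{MSO}_2$ convergence law.
   Context: $T_L^d=(\mathbb Z/L\mathbb Z)^d$ is the (simple) graph in which two vertices are adjacent if they differ by $1$ or $-1$ modulo $L$ in exactly one coordinate and agree in all other coordinates; it has $N=L^d$ vertices. $X_L^d(q_N)$ is the random subgraph of $T_L^d$ on the full vertex set in which each edge is retained with probability $q_N$ and omitted with probability $p_N=1-q_N$, independently. $\mathrm{MSO}_2$ is monadic second-order logic over the two-sorted incidence structure of a graph (a vertex sort, an edge sort, and the incidence relation): one may quantify over vertices, edges, sets of vertices and sets of edges. $\mathrm{MSO}_1$ is the fragment in which set variables range only over sets of vertices. $(X_L)$ has a convergence law for a logic if $\mathbb P(X_L\models\varphi)$ converges as $L\to\infty$ for every sentence $\varphi$ of that logic. *)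

theory Defs
  imports "HOL-Probability.Probability" "HOL-Number_Theory.Cong"
begin

section \<open>Graphs and the torus\<close>

text \<open>A simple graph is a pair of a vertex set and a set of edges, an edge being the
  two-element set of its endpoints; the incidence relation is therefore membership.\<close>

type_synonym 'v graph = "'v set \<times> 'v set set"

abbreviation verts :: "'v graph \<Rightarrow> 'v set" where "verts \<equiv> fst"
abbreviation edges :: "'v graph \<Rightarrow> 'v set set" where "edges \<equiv> snd"

text \<open>Residues modulo \<open>L\<close> are represented by \<open>0, \<dots>, L - 1\<close>.\<close>

definition torus_verts :: "nat \<Rightarrow> nat \<Rightarrow> (nat \<Rightarrow> nat) set" where
  "torus_verts d L = {..<d} \<rightarrow>\<^sub>E {..<L}"

text \<open>The condition \<open>u i \<noteq> v i\<close> only matters for \<open>L = 1\<close>, where it excludes a loop.\<close>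

definition torus_adj :: "nat \<Rightarrow> nat \<Rightarrow> (nat \<Rightarrow> nat) \<Rightarrow> (nat \<Rightarrow> nat) \<Rightarrow> bool" where
  "torus_adj d L u v \<longleftrightarrow>
     (\<exists>i<d. u i \<noteq> v i \<and> ([u i = v i + 1] (mod L) \<or> [v i = u i + 1] (mod L)) \<and>
            (\<forall>j<d. j \<noteq> i \<longrightarrow> u j = v j))"

definition torus :: "nat \<Rightarrow> nat \<Rightarrow> (nat \<Rightarrow> nat) graph" where
  "torus d L = (torus_verts d L,
     {{u, v} | u v. u \<in> torus_verts d L \<and> v \<in> torus_verts d L \<and> torus_adj d L u v})"

section \<open>Bond percolation\<close>

definition percolation :: "'v graph \<Rightarrow> real \<Rightarrow> 'v graph pmf" where
  "percolation G q =
     map_pmf (\<lambda>\<omega>. (verts G, {e \<in> edges G. \<omega> e}))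
       (Pi_pmf (edges G) False (\<lambda>_. bernoulli_pmf q))"

definition torus_percolation :: "nat \<Rightarrow> (nat \<Rightarrow> real) \<Rightarrow> nat \<Rightarrow> (nat \<Rightarrow> nat) graph pmf" where
  "torus_percolation d q L = percolation (torus d L) (q (L ^ d))"

section \<open>Monadic second-order logic of graphs\<close>

text \<open>There are four sorts of variables, each indexed by the natural numbers: for
  vertices, edges, sets of vertices and sets of edges. The atomic formulas are equality of
  vertices, equality of edges, incidence of a vertex with an edge, and membership in
  a set of vertices or of edges.\<close>

datatype mso =
    EqV nat nat
  | EqE nat nat
  | Inc nat nat
  | MemV nat nat
  | MemE nat nat
  | Neg mso
  | Conj mso mso
  | ExV nat mso
  | ExE nat mso
  | ExVS nat mso
  | ExES nat mso

text \<open>The arguments \<open>x\<close>, \<open>y\<close>, \<open>X\<close>, \<open>Y\<close> assign values to vertex, edge, vertex set and edge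
  set variables.\<close>

primrec sat :: "'v graph \<Rightarrow> (nat \<Rightarrow> 'v) \<Rightarrow> (nat \<Rightarrow> 'v set) \<Rightarrow> (nat \<Rightarrow> 'v set) \<Rightarrow>
    (nat \<Rightarrow> 'v set set) \<Rightarrow> mso \<Rightarrow> bool" where
  "sat G x y X Y (EqV m n) \<longleftrightarrow> x m = x n"
| "sat G x y X Y (EqE m n) \<longleftrightarrow> y m = y n"
| "sat G x y X Y (Inc m n) \<longleftrightarrow> x m \<in> y n"
| "sat G x y X Y (MemV m n) \<longleftrightarrow> x m \<in> X n"
| "sat G x y X Y (MemE m n) \<longleftrightarrow> y m \<in> Y n"
| "sat G x y X Y (Neg \<phi>) \<longleftrightarrow> \<not> sat G x y X Y \<phi>"
| "sat G x y X Y (Conj \<phi> \<psi>) \<longleftrightarrow> sat G x y X Y \<phi> \<and> sat G x y X Y \<psi>"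
| "sat G x y X Y (ExV n \<phi>) \<longleftrightarrow> (\<exists>v\<in>verts G. sat G (x(n := v)) y X Y \<phi>)"
| "sat G x y X Y (ExE n \<phi>) \<longleftrightarrow> (\<exists>e\<in>edges G. sat G x (y(n := e)) X Y \<phi>)"
| "sat G x y X Y (ExVS n \<phi>) \<longleftrightarrow> (\<exists>S\<subseteq>verts G. sat G x y (X(n := S)) Y \<phi>)"
| "sat G x y X Y (ExES n \<phi>) \<longleftrightarrow> (\<exists>F\<subseteq>edges G. sat G x y X (Y(n := F)) \<phi>)"

datatype mso_var = Vert nat | Edge nat | VSet nat | ESet nat

primrec free_vars :: "mso \<Rightarrow> mso_var set" where
  "free_vars (EqV m n) = {Vert m, Vert n}"
| "free_vars (EqE m n) = {Edge m, Edge n}"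
| "free_vars (Inc m n) = {Vert m, Edge n}"
| "free_vars (MemV m n) = {Vert m, VSet n}"
| "free_vars (MemE m n) = {Edge m, ESet n}"
| "free_vars (Neg \<phi>) = free_vars \<phi>"
| "free_vars (Conj \<phi> \<psi>) = free_vars \<phi> \<union> free_vars \<psi>"
| "free_vars (ExV n \<phi>) = free_vars \<phi> - {Vert n}"
| "free_vars (ExE n \<phi>) = free_vars \<phi> - {Edge n}"
| "free_vars (ExVS n \<phi>) = free_vars \<phi> - {VSet n}"
| "free_vars (ExES n \<phi>) = free_vars \<phi> - {ESet n}"

primrec no_edge_sets :: "mso \<Rightarrow> bool" where
  "no_edge_sets (EqV m n) \<longleftrightarrow> True"
| "no_edge_sets (EqE m n) \<longleftrightarrow> True"
| "no_edge_sets (Inc m n) \<longleftrightarrow> True"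
| "no_edge_sets (MemV m n) \<longleftrightarrow> True"
| "no_edge_sets (MemE m n) \<longleftrightarrow> False"
| "no_edge_sets (Neg \<phi>) \<longleftrightarrow> no_edge_sets \<phi>"
| "no_edge_sets (Conj \<phi> \<psi>) \<longleftrightarrow> no_edge_sets \<phi> \<and> no_edge_sets \<psi>"
| "no_edge_sets (ExV n \<phi>) \<longleftrightarrow> no_edge_sets \<phi>"
| "no_edge_sets (ExE n \<phi>) \<longleftrightarrow> no_edge_sets \<phi>"
| "no_edge_sets (ExVS n \<phi>) \<longleftrightarrow> no_edge_sets \<phi>"
| "no_edge_sets (ExES n \<phi>) \<longleftrightarrow> False"

definition MSO2 :: "mso set" where
  "MSO2 = {\<phi>. free_vars \<phi> = {}}"

definition MSO1 :: "mso set" where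
  "MSO1 = {\<phi> \<in> MSO2. no_edge_sets \<phi>}"

text \<open>For a sentence the choice of the assignments is irrelevant. They are not
  required to take values in \<open>G\<close>, as \<open>G\<close> may have no edges.\<close>

definition models :: "'v graph \<Rightarrow> mso \<Rightarrow> bool" (infix "\<Turnstile>" 50) where
  "G \<Turnstile> \<phi> \<longleftrightarrow> (\<forall>x y X Y. sat G x y X Y \<phi>)"

section \<open>Convergence laws\<close>

text \<open>The term at \<open>L = 0\<close> has no influence on convergence.\<close>

definition convergence_law :: "mso set \<Rightarrow> (nat \<Rightarrow> 'v graph pmf) \<Rightarrow> bool" where
  "convergence_law \<L> X \<longleftrightarrow>
     (\<forall>\<phi>\<in>\<L>. convergent (\<lambda>L. measure_pmf.prob (X L) {G. G \<Turnstile> \<phi>}))"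

end

theory Submission imports Defs begin

text \<open>
  Two-colourability of a graph is an \<open>MSO\<^sub>1\<close> property, and its probability oscillates with the
  parity of \<open>L\<close>. If \<open>L\<close> is even, then the parity of the coordinate sum is a proper
  two-colouring of the torus, hence of each of its subgraphs, and the probability is \<open>1\<close>
  (\<open>two_colourable_torus\<close>, \<open>two_colourable_subgraph\<close>). If \<open>L \<ge> 3\<close> is odd, then a line in the
  first coordinate direction closes up to a cycle of odd length \<open>L\<close>. By the union bound this one
  cycle survives percolation with probability at least \<open>1 - L p\<^sub>N\<close>, which tends to \<open>1\<close>, and then
  no two-colouring exists (\<open>prob_percolation_loses_edge\<close>,
  \<open>not_two_colourable_odd_cycle\<close>).
  So the probabilities tend to \<open>1\<close> along even \<open>L\<close> and to \<open>0\<close> along odd \<open>L\<close>. Only one fixed cycle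
  has to survive; for \<open>d \<ge> 2\<close> the graph as a whole may well lose many edges.
\<close>

section \<open>Two-colourability as a sentence\<close>

text \<open>An edge of a simple graph has exactly two ends, so an end in \<open>S\<close> and an end outside \<open>S\<close> give them
  different colours. This form refers to the edge by incidence only, as the logic does.\<close>

definition two_colourable :: "'v graph \<Rightarrow> bool" where
  "two_colourable G \<longleftrightarrow>
     (\<exists>S\<subseteq>verts G. \<forall>e\<in>edges G. \<exists>u\<in>verts G. \<exists>v\<in>verts G. u \<in> e \<and> u \<in> S \<and> v \<in> e \<and> v \<notin> S)"

definition two_colourable_sentence :: mso where
  "two_colourable_sentence =
     ExVS 0 (Neg (ExE 0 (Neg (ExV 0 (ExV 1
       (Conj (Conj (Inc 0 0) (MemV 0 0)) (Conj (Inc 1 0) (Neg (MemV 1 0)))))))))"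

lemma two_colourable_sentence_MSO1: "two_colourable_sentence \<in> MSO1"
  by (auto simp: two_colourable_sentence_def MSO1_def MSO2_def)

lemma models_two_colourable_sentence: "G \<Turnstile> two_colourable_sentence \<longleftrightarrow> two_colourable G"
  by (simp add: models_def two_colourable_sentence_def two_colourable_def conj.left_commute)

lemma two_colourable_subgraph:
  assumes "two_colourable G" "verts H = verts G" "edges H \<subseteq> edges G"
  shows "two_colourable H"
proof -
  obtain S where "S \<subseteq> verts G"
    "\<forall>e\<in>edges G. \<exists>u\<in>verts G. \<exists>v\<in>verts G. u \<in> e \<and> u \<in> S \<and> v \<in> e \<and> v \<notin> S"
    using assms(1) unfolding two_colourable_def by (elim exE conjE)
  then show ?thesis
    using assms(2,3) unfolding two_colourable_def by (intro exI[of _ S]) (simp add: subset_iff)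
qed

text \<open>Along a properly coloured path the colours alternate, so after an even number \<open>L - 1\<close> of
  steps the colour of \<open>c 0\<close> recurs, in conflict with the closing edge.\<close>

lemma not_two_colourable_odd_cycle:
  assumes "odd L" and cycle: "\<And>k. k < L \<Longrightarrow> {c k, c (Suc k mod L)} \<in> edges G"
  shows "\<not> two_colourable G"
proof
  assume "two_colourable G"
  then obtain S where S:
    "\<forall>e\<in>edges G. \<exists>u\<in>verts G. \<exists>v\<in>verts G. u \<in> e \<and> u \<in> S \<and> v \<in> e \<and> v \<notin> S"
    unfolding two_colourable_def by (elim exE conjE)
  have flip: "c (Suc k mod L) \<in> S \<longleftrightarrow> c k \<notin> S" if "k < L" for k
    using bspec[OF S cycle[OF that]] by auto
  have alternate: "c k \<in> S \<longleftrightarrow> (c 0 \<in> S \<longleftrightarrow> even k)" if "k < L" for k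
    using that
  proof (induction k)
    case (Suc k)
    then show ?case using flip[of k] by auto
  qed simp
  from \<open>odd L\<close> have "L > 0" by (simp add: odd_pos)
  then show False
    using alternate[of "L - 1"] flip[of "L - 1"] \<open>odd L\<close> by simp
qed

section \<open>Percolation on a finite graph\<close>

lemma two_colourable_percolation:
  assumes "two_colourable G"
  shows "measure_pmf.prob (percolation G q) {H. two_colourable H} = 1"
proof -
  have "AE H in percolation G q. two_colourable H"
    by (auto simp: AE_measure_pmf_iff percolation_def intro: two_colourable_subgraph[OF assms])
  then show ?thesis
    by (subst measure_pmf.prob_eq_1) auto
qed

lemma prob_percolation_loses_edge:
  assumes "finite (edges G)" "F \<subseteq> edges G" and q: "0 \<le> q" "q \<le> 1"
  shows "measure_pmf.prob (percolation G q) {H. \<not> F \<subseteq> edges H} \<le> real (card F) * (1 - q)"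
proof -
  let ?P = "Pi_pmf (edges G) False (\<lambda>_. bernoulli_pmf q)"
  have "finite F" using assms finite_subset by blast
  have edge: "measure_pmf.prob ?P {\<omega>. \<not> \<omega> e} = 1 - q" if "e \<in> F" for e
  proof -
    have "map_pmf (\<lambda>\<omega>. \<omega> e) ?P = bernoulli_pmf q"
      using that assms by (subst Pi_pmf_component) auto
    moreover have "measure_pmf.prob (map_pmf (\<lambda>\<omega>. \<omega> e) ?P) {False}
        = measure_pmf.prob ?P {\<omega>. \<not> \<omega> e}"
      by (simp add: vimage_def)
    ultimately show ?thesis
      using q by (simp add: measure_pmf_single)
  qed
  have "(\<lambda>\<omega>. (verts G, {e \<in> edges G. \<omega> e})) -` {H. \<not> F \<subseteq> edges H}
      = (\<Union>e\<in>F. {\<omega>. \<not> \<omega> e})"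
    using assms(2) by auto
  then have "measure_pmf.prob (percolation G q) {H. \<not> F \<subseteq> edges H}
      = measure_pmf.prob ?P (\<Union>e\<in>F. {\<omega>. \<not> \<omega> e})"
    unfolding percolation_def measure_map_pmf by (rule arg_cong)
  also have "\<dots> \<le> (\<Sum>e\<in>F. measure_pmf.prob ?P {\<omega>. \<not> \<omega> e})"
    using \<open>finite F\<close> by (intro measure_pmf.finite_measure_subadditive_finite) auto
  also have "\<dots> = real (card F) * (1 - q)"
    using edge by simp
  finally show ?thesis .
qed

section \<open>The torus\<close>

lemma finite_edges_torus: "finite (edges (torus d L))"
proof -
  have "edges (torus d L) \<subseteq> Pow (torus_verts d L)"
    by (auto simp: torus_def)
  moreover have "finite (torus_verts d L)"
    by (simp add: torus_verts_def finite_PiE)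
  ultimately show ?thesis
    using finite_subset by blast
qed

lemma even_cong_iff:
  fixes a b L :: nat
  assumes "even L" "[a = b] (mod L)"
  shows "even a \<longleftrightarrow> even b"
proof -
  have "[a = b] (mod 2)"
    using assms(2,1) by (rule cong_dvd_modulus_nat)
  then show ?thesis
    by (rule cong_dvd_iff)
qed

text \<open>A step changes one coordinate by \<open>\<plusminus>1\<close> modulo \<open>L\<close>. For even \<open>L\<close> reduction modulo \<open>L\<close>
  preserves parity, so the step changes the parity of the coordinate sum.\<close>

lemma torus_adj_flips_parity:
  assumes "even L" "torus_adj d L u v"
  shows "even (\<Sum>i<d. u i) \<longleftrightarrow> odd (\<Sum>i<d. v i)"
proof -
  obtain i where i: "i < d" "[u i = v i + 1] (mod L) \<or> [v i = u i + 1] (mod L)"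
    and rest: "\<And>j. j < d \<Longrightarrow> j \<noteq> i \<Longrightarrow> u j = v j"
    using assms(2) unfolding torus_adj_def by blast
  have "even (u i) \<longleftrightarrow> odd (v i)"
    using i(2) even_cong_iff[OF \<open>even L\<close>, of "u i" "v i + 1"]
      even_cong_iff[OF \<open>even L\<close>, of "v i" "u i + 1"] by auto
  moreover have "(\<Sum>j\<in>{..<d} - {i}. u j) = (\<Sum>j\<in>{..<d} - {i}. v j)"
    using rest by (intro sum.cong) auto
  ultimately show ?thesis
    using sum.remove[of "{..<d}" i u] sum.remove[of "{..<d}" i v] i(1) by auto
qed

lemma two_colourable_torus:
  assumes "even L"
  shows "two_colourable (torus d L)"
  unfolding two_colourable_def
proof (intro exI conjI ballI)
  let ?S = "{u \<in> torus_verts d L. even (\<Sum>i<d. u i)}"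
  show "?S \<subseteq> verts (torus d L)"
    by (auto simp: torus_def)
  fix e assume "e \<in> edges (torus d L)"
  then obtain u v where uv: "e = {u, v}" "u \<in> torus_verts d L" "v \<in> torus_verts d L"
    "torus_adj d L u v"
    by (auto simp: torus_def)
  with torus_adj_flips_parity[OF assms uv(4)]
  show "\<exists>u\<in>verts (torus d L). \<exists>v\<in>verts (torus d L). u \<in> e \<and> u \<in> ?S \<and> v \<in> e \<and> v \<notin> ?S"
    by (cases "even (\<Sum>i<d. u i)") (auto simp: torus_def)
qed

definition axis_point :: "nat \<Rightarrow> nat \<Rightarrow> nat \<Rightarrow> nat" where
  "axis_point d k = (\<lambda>i\<in>{..<d}. if i = 0 then k else 0)"

text \<open>For \<open>L = 1\<close> the cycle would degenerate to a loop.\<close>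

lemma axis_cycle_edge:
  assumes "d \<ge> 1" "L \<ge> 2" "k < L"
  shows "{axis_point d k, axis_point d (Suc k mod L)} \<in> edges (torus d L)"
proof -
  have "k \<noteq> Suc k mod L"
    using assms by (cases "Suc k = L") auto
  then have "torus_adj d L (axis_point d k) (axis_point d (Suc k mod L))"
    using assms unfolding torus_adj_def
    by (intro exI[of _ 0]) (auto simp: axis_point_def cong_def)
  moreover have "axis_point d j \<in> torus_verts d L" if "j < L" for j
    using that by (auto simp: axis_point_def torus_verts_def)
  moreover have "Suc k mod L < L"
    using assms by simp
  ultimately show ?thesis
    using \<open>k < L\<close> unfolding torus_def snd_conv by blast
qed

lemma prob_two_colourable_odd_torus:
  assumes "d \<ge> 1" "L \<ge> 2" "odd L" and q: "0 \<le> q" "q \<le> 1"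
  shows "measure_pmf.prob (percolation (torus d L) q) {H. two_colourable H} \<le> real L * (1 - q)"
proof -
  let ?F = "(\<lambda>k. {axis_point d k, axis_point d (Suc k mod L)}) ` {..<L}"
  have "\<not> ?F \<subseteq> edges H" if "two_colourable H" for H
    using not_two_colourable_odd_cycle[OF \<open>odd L\<close>, of "axis_point d" H] that by blast
  then have "measure_pmf.prob (percolation (torus d L) q) {H. two_colourable H}
      \<le> measure_pmf.prob (percolation (torus d L) q) {H. \<not> ?F \<subseteq> edges H}"
    by (intro measure_pmf.finite_measure_mono) auto
  also have "\<dots> \<le> real (card ?F) * (1 - q)"
    using axis_cycle_edge[OF assms(1,2)] q
    by (intro prob_percolation_loses_edge finite_edges_torus) auto
  also have "\<dots> \<le> real L * (1 - q)"
    using card_image_le[of "{..<L}"] q by (intro mult_right_mono) auto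
  finally show ?thesis .
qed

section \<open>Failure of the convergence law\<close>

theorem proposition5p4:
  fixes d :: nat and q :: "nat \<Rightarrow> real"
  assumes "d \<ge> 1"
    and "\<And>L. L \<ge> 1 \<Longrightarrow> q (L ^ d) \<in> {0..1}"
    and "(\<lambda>L. real L * (1 - q (L ^ d))) \<longlonglongrightarrow> 0"
  shows "\<not> convergence_law MSO1 (torus_percolation d q) \<and>
         \<not> convergence_law MSO2 (torus_percolation d q)"
proof -
  define P where "P L = measure_pmf.prob (torus_percolation d q L) {G. two_colourable G}" for L
  have even: "P (2 * n) = 1" for n
    using two_colourable_percolation[OF two_colourable_torus]
    by (simp add: P_def torus_percolation_def)
  have odd: "P (2 * n + 1) \<le> real (2 * n + 1) * (1 - q ((2 * n + 1) ^ d))" if "n \<ge> 1" for n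
    using prob_two_colourable_odd_torus[of d "2 * n + 1"] assms(1) assms(2)[of "2 * n + 1"] that
    by (simp add: P_def torus_percolation_def)
  have "\<not> convergent P"
  proof
    assume "convergent P"
    then obtain l where l: "P \<longlonglongrightarrow> l"
      by (auto simp: convergent_def)
    have "(\<lambda>n. P (2 * n)) \<longlonglongrightarrow> l"
      using LIMSEQ_subseq_LIMSEQ[OF l, of "\<lambda>n. 2 * n"] by (simp add: strict_mono_def o_def)
    then have "l = 1"
      using LIMSEQ_unique[of "\<lambda>n. P (2 * n)" l 1] by (simp add: even)
    have "(\<lambda>n. P (2 * n + 1)) \<longlonglongrightarrow> l"
      using LIMSEQ_subseq_LIMSEQ[OF l, of "\<lambda>n. 2 * n + 1"] by (simp add: strict_mono_def o_def)
    moreover have "(\<lambda>n. real (2 * n + 1) * (1 - q ((2 * n + 1) ^ d))) \<longlonglongrightarrow> 0"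
      using LIMSEQ_subseq_LIMSEQ[OF assms(3), of "\<lambda>n. 2 * n + 1"]
      by (simp add: strict_mono_def o_def)
    ultimately have "l \<le> 0"
      using odd by (intro LIMSEQ_le) auto
    with \<open>l = 1\<close> show False by simp
  qed
  then have "\<not> convergent (\<lambda>L. measure_pmf.prob (torus_percolation d q L)
      {G. G \<Turnstile> two_colourable_sentence})"
    by (simp add: models_two_colourable_sentence P_def[abs_def])
  moreover have "two_colourable_sentence \<in> MSO2"
    using two_colourable_sentence_MSO1 by (simp add: MSO1_def)
  ultimately show ?thesis
    using two_colourable_sentence_MSO1 unfolding convergence_law_def by blast
qed

end
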